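(* Let $\sigma$ be a nonnegative locally finite Borel measure on $\mathbb{R}_+=(0,+\infty)$ and let $0<q<1$. There exists a positive constant $\varkappa$ such that $$\Big(\int_0^{+\infty}\big(\mathbf{G}\nu(x)\big)^q\,d\sigma(x)\Big)^{1/q}\le \varkappa\,\|\nu\|\quad\text{for all } \nu\in\mathcal{M}^+(\mathbb{R}_+)$$ if and only if $$\int_0^{+\infty}x^q\,d\sigma(x)<+\infty .$$ Moreover, the best (smallest) constant $\varkappa(\sigma)$ in the inequality satisfies $$\varkappa(\sigma)^q=\int_0^{+\infty}x^q\,d\sigma(x).$$
   Context: $\mathcal{M}^+(\mathbb{R}_+)$ denotes the class of all nonnegative locally finite Borel measures on $\mathbb{R}_+=(0,+\infty)$, and $\|\nu\|=\nu(\mathbb{R}_+)\in[0,+\infty]$. For $\nu\in\mathcal{M}^+(\mathbb{R}_+)$, $\mathbf{G}\nu(x)=\int_{\mathbb{R}_+}\min(x,y)\,d\nu(y)$, $x>0$. The best constant is the infimum of all admissible $\varkappa>0$. *)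

theory Defs
  imports "HOL-Analysis.Analysis"
begin

text \<open>The class \<open>M\<^sup>+(R\<^sub>+)\<close>. The Borel sets of \<open>{0<..}\<close> are the trace of those of the real
  line, and local finiteness refers to the space \<open>{0<..}\<close>: no finiteness is required near 0.\<close>

definition Mplus :: "real measure set" where
  "Mplus = {\<nu>. sets \<nu> = sets (restrict_space borel {0<..}) \<and>
     (\<forall>x>0. \<exists>U. open U \<and> x \<in> U \<and> U \<subseteq> {0<..} \<and> emeasure \<nu> U < \<infinity>)}"

definition Green :: "real measure \<Rightarrow> real \<Rightarrow> ennreal" where
  "Green \<nu> x = (\<integral>\<^sup>+ y. ennreal (min x y) \<partial>\<nu>)"

text \<open>Powers with a positive exponent on \<open>[0, \<infinity>]\<close>, with \<open>\<infinity>\<^sup>p = \<infinity>\<close>.\<close>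

definition epowr :: "ennreal \<Rightarrow> real \<Rightarrow> ennreal" where
  "epowr a p = (if a = \<infinity> then \<infinity> else ennreal (enn2real a powr p))"

definition admissible :: "real measure \<Rightarrow> real \<Rightarrow> real \<Rightarrow> bool" where
  "admissible \<sigma> q \<kappa> \<longleftrightarrow> \<kappa> > 0 \<and>
     (\<forall>\<nu>\<in>Mplus. epowr (\<integral>\<^sup>+ x. epowr (Green \<nu> x) q \<partial>\<sigma>) (1 / q) \<le> ennreal \<kappa> * emeasure \<nu> (space \<nu>))"

text \<open>The infimum is taken in \<open>[0, \<infinity>]\<close>, so it is \<open>\<infinity>\<close> if no real constant is admissible.\<close>

definition best_constant :: "real measure \<Rightarrow> real \<Rightarrow> ennreal" where
  "best_constant \<sigma> q = Inf (ennreal ` {\<kappa>. admissible \<sigma> q \<kappa>})"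

end

theory Submission
  imports Defs "HOL-Probability.Giry_Monad"
begin

text \<open>Since \<open>min x y \<le> x\<close>, the potential satisfies \<open>G\<nu>(x) \<le> x \<parallel>\<nu>\<parallel>\<close>, which gives the inequality
  with \<open>\<kappa>\<^sup>q = \<integral> x\<^sup>q d\<sigma>\<close>. Conversely, testing the inequality on the Dirac mass at \<open>n\<close>, whose potential
  is \<open>min x n\<close>, and letting \<open>n\<close> tend to infinity shows by monotone convergence that no smaller
  constant works.\<close>

lemma epowr_top [simp]: "epowr top p = top"
  by (simp add: epowr_def)

lemma epowr_ennreal [simp]: "0 \<le> r \<Longrightarrow> epowr (ennreal r) p = ennreal (r powr p)"
  by (simp add: epowr_def)

lemma epowr_mono:
  assumes "a \<le> b" "0 \<le> p"
  shows "epowr a p \<le> epowr b p"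
proof (cases b)
  case (real s)
  with assms obtain r where "0 \<le> r" "a = ennreal r"
    by (cases a) (auto simp: top_unique)
  with real assms show ?thesis
    by (simp add: powr_mono2)
qed simp

lemma epowr_epowr_inverse: "p \<noteq> 0 \<Longrightarrow> epowr (epowr a (1 / p)) p = a"
  by (cases a) (simp_all add: powr_powr)

text \<open>The powers with exponents \<open>p\<close> and \<open>1 / p\<close> are monotone and
  mutually inverse on the extended half-line, infinity included. This moves the outer exponent
  \<open>1 / q\<close> of the inequality to the constant, leaving a bound on the integral
  itself.\<close>

lemma epowr_inverse_le_iff:
  assumes "0 < p" "0 \<le> r"
  shows "epowr a (1 / p) \<le> ennreal r \<longleftrightarrow> a \<le> ennreal (r powr p)"
proof
  assume "epowr a (1 / p) \<le> ennreal r"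
  from epowr_mono[OF this, of p] assms show "a \<le> ennreal (r powr p)"
    by (simp add: epowr_epowr_inverse)
next
  assume "a \<le> ennreal (r powr p)"
  from epowr_mono[OF this, of "1 / p"] assms show "epowr a (1 / p) \<le> ennreal r"
    by (simp add: powr_powr)
qed

lemma sets_Mplus: "\<nu> \<in> Mplus \<Longrightarrow> sets \<nu> = sets (restrict_space borel {0<..})"
  by (simp add: Mplus_def)

lemma space_Mplus: "\<nu> \<in> Mplus \<Longrightarrow> space \<nu> = {0<..}"
  using sets_eq_imp_space_eq[OF sets_Mplus] by (simp add: space_restrict_space)

text \<open>Integrands are written as functions on the whole real line, whereas measures in
  \<open>Mplus\<close> carry the trace sigma-algebra on \<open>{0<..}\<close>; restriction preserves
  measurability.\<close>

lemma measurable_Mplus: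
  assumes "\<nu> \<in> Mplus" "f \<in> borel_measurable borel"
  shows "f \<in> borel_measurable \<nu>"
  using measurable_restrict_space1[OF assms(2), of "{0<..}"]
  by (simp cong: measurable_cong_sets add: sets_Mplus[OF assms(1)])

lemma Green_le: "Green \<nu> x \<le> ennreal x * emeasure \<nu> (space \<nu>)"
proof -
  have "Green \<nu> x \<le> (\<integral>\<^sup>+ y. ennreal x \<partial>\<nu>)"
    unfolding Green_def by (intro nn_integral_mono ennreal_leI) simp
  then show ?thesis by simp
qed

abbreviation dirac :: "real \<Rightarrow> real measure" where
  "dirac a \<equiv> return (restrict_space borel {0<..}) a"

lemma dirac_total: "0 < a \<Longrightarrow> emeasure (dirac a) (space (dirac a)) = 1"
  by (simp add: emeasure_return space_restrict_space sets_restrict_space_iff)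

lemma dirac_Mplus:
  assumes "0 < a"
  shows "dirac a \<in> Mplus"
proof -
  have "emeasure (dirac a) {0<..} < top"
    using dirac_total[OF assms] by (simp add: space_restrict_space)
  then show ?thesis
    \<comment> \<open>The total mass is finite, so the whole half-line serves as the neighbourhood
      of every point.\<close>
    unfolding Mplus_def by (auto intro!: exI[of _ "{0<..}"])
qed

lemma Green_dirac:
  assumes "0 < a"
  shows "Green (dirac a) x = ennreal (min x a)"
  unfolding Green_def using assms
  by (subst nn_integral_return) (auto simp: space_restrict_space intro!: measurable_restrict_space1)

lemma admissible_if:
  assumes "\<sigma> \<in> Mplus" "0 < q" "0 < \<kappa>"
    and I: "(\<integral>\<^sup>+ x. ennreal (x powr q) \<partial>\<sigma>) \<le> ennreal (\<kappa> powr q)"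
  shows "admissible \<sigma> q \<kappa>"
  unfolding admissible_def
proof (intro conjI ballI)
  show "epowr (\<integral>\<^sup>+ x. epowr (Green \<nu> x) q \<partial>\<sigma>) (1 / q) \<le> ennreal \<kappa> * emeasure \<nu> (space \<nu>)" for \<nu>
  proof (cases "emeasure \<nu> (space \<nu>)")
    \<comment> \<open>Infinite mass makes the right-hand side infinite because
      \<open>\<kappa>\<close> is positive; in the other case the mass is a real \<open>c\<close>
      that can be pulled out of the power.\<close>
    case top
    with \<open>0 < \<kappa>\<close> show ?thesis by (simp add: ennreal_mult_top)
  next
    case (real c)
    have "(\<integral>\<^sup>+ x. epowr (Green \<nu> x) q \<partial>\<sigma>) \<le> (\<integral>\<^sup>+ x. ennreal (x powr q) * ennreal (c powr q) \<partial>\<sigma>)"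
    proof (rule nn_integral_mono)
      fix x assume "x \<in> space \<sigma>"
      then have "0 < x" using assms by (simp add: space_Mplus)
      have "epowr (Green \<nu> x) q \<le> epowr (ennreal (x * c)) q"
        using Green_le[of \<nu> x] real \<open>0 < x\<close> \<open>0 < q\<close>
        by (intro epowr_mono) (simp_all add: ennreal_mult)
      also have "\<dots> = ennreal (x powr q) * ennreal (c powr q)"
        using \<open>0 < x\<close> \<open>0 \<le> c\<close> by (simp add: powr_mult flip: ennreal_mult)
      finally show "epowr (Green \<nu> x) q \<le> ennreal (x powr q) * ennreal (c powr q)" .
    qed
    also have "\<dots> = (\<integral>\<^sup>+ x. ennreal (x powr q) \<partial>\<sigma>) * ennreal (c powr q)"
      by (rule nn_integral_multc, rule measurable_Mplus[OF assms(1)]) measurable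
    also have "\<dots> \<le> ennreal (\<kappa> powr q) * ennreal (c powr q)"
      by (rule mult_right_mono[OF I]) simp
    also have "\<dots> = ennreal ((\<kappa> * c) powr q)"
      using \<open>0 < \<kappa>\<close> \<open>0 \<le> c\<close> by (simp add: powr_mult ennreal_mult)
    finally show ?thesis
      using assms real by (simp add: epowr_inverse_le_iff flip: ennreal_mult)
  qed
qed (fact \<open>0 < \<kappa>\<close>)

lemma admissible_imp:
  assumes "\<sigma> \<in> Mplus" "0 < q" "admissible \<sigma> q \<kappa>"
  shows "(\<integral>\<^sup>+ x. ennreal (x powr q) \<partial>\<sigma>) \<le> ennreal (\<kappa> powr q)"
proof -
  \<comment> \<open>This is the \<open>q\<close>-th power of the potential of the Dirac mass at
    \<open>Suc n\<close>; the successor keeps that point inside \<open>{0<..}\<close> even for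
    \<open>n = 0\<close>.\<close>
  define f where "f n x = ennreal (min x (real (Suc n)) powr q)" for n x
  have bound: "integral\<^sup>N \<sigma> (f n) \<le> ennreal (\<kappa> powr q)" for n
  proof -
    let ?\<delta> = "dirac (real (Suc n))"
    have mass: "emeasure ?\<delta> (space ?\<delta>) = 1"
      by (rule dirac_total) simp
    have "?\<delta> \<in> Mplus"
      by (rule dirac_Mplus) simp
    with assms(3) have "epowr (\<integral>\<^sup>+ x. epowr (Green ?\<delta> x) q \<partial>\<sigma>) (1 / q) \<le> ennreal \<kappa> * emeasure ?\<delta> (space ?\<delta>)"
      by (simp only: admissible_def)
    then have "epowr (\<integral>\<^sup>+ x. epowr (Green ?\<delta> x) q \<partial>\<sigma>) (1 / q) \<le> ennreal \<kappa>"
      by (simp only: mass mult_1_right)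
    moreover have "(\<integral>\<^sup>+ x. epowr (Green ?\<delta> x) q \<partial>\<sigma>) = integral\<^sup>N \<sigma> (f n)"
      using assms(1) by (intro nn_integral_cong) (simp add: f_def Green_dirac space_Mplus)
    moreover have "0 < \<kappa>"
      using assms(3) by (simp add: admissible_def)
    ultimately show ?thesis
      using \<open>0 < q\<close> by (simp only: epowr_inverse_le_iff less_imp_le)
  qed
  have "(\<integral>\<^sup>+ x. ennreal (x powr q) \<partial>\<sigma>) \<le> (\<integral>\<^sup>+ x. (SUP n. f n x) \<partial>\<sigma>)"
  proof (rule nn_integral_mono)
    fix x
    \<comment> \<open>The supremum is attained: once the Dirac point has passed \<open>x\<close>,
      truncation no longer changes \<open>x\<close>.\<close>
    obtain n where "x \<le> real n" using real_arch_simple by blast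
    then have "ennreal (x powr q) = f n x" by (simp add: f_def min_def)
    also have "\<dots> \<le> (SUP n. f n x)" by (rule SUP_upper) simp
    finally show "ennreal (x powr q) \<le> (SUP n. f n x)" .
  qed
  also have "\<dots> = (SUP n. integral\<^sup>N \<sigma> (f n))"
  proof (rule nn_integral_monotone_convergence_SUP_AE)
    \<comment> \<open>\<open>AE_I2\<close> restricts attention to points of the space, which are
      positive, so \<open>powr_mono2\<close> applies to the truncations.\<close>
    show "AE x in \<sigma>. f n x \<le> f (Suc n) x" for n
      using assms by (intro AE_I2) (auto simp: f_def space_Mplus intro!: ennreal_leI powr_mono2)
    show "f n \<in> borel_measurable \<sigma>" for n
      unfolding f_def by (rule measurable_Mplus[OF assms(1)]) measurable
  qed
  also have "\<dots> \<le> ennreal (\<kappa> powr q)"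
    by (rule SUP_least) (rule bound)
  finally show ?thesis .
qed

text \<open>Sufficiency and necessity meet at the same threshold, so the admissible constants are
  exactly the positive reals above an explicit value, possibly 0 or infinity.\<close>

lemma admissible_iff:
  assumes "\<sigma> \<in> Mplus" "0 < q"
  shows "admissible \<sigma> q \<kappa> \<longleftrightarrow> 0 < \<kappa> \<and> epowr (\<integral>\<^sup>+ x. ennreal (x powr q) \<partial>\<sigma>) (1 / q) \<le> ennreal \<kappa>"
  using admissible_if[OF assms, of \<kappa>] admissible_imp[OF assms, of \<kappa>] assms(2)
  by (auto simp: epowr_inverse_le_iff admissible_def)

lemma Inf_ennreal_positive_upper_bounds: "Inf (ennreal ` {r. 0 < r \<and> a \<le> ennreal r}) = a"
proof (cases a)
  case (real s)
  have "Inf (ennreal ` {r. 0 < r \<and> a \<le> ennreal r}) \<le> a"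
  \<comment> \<open>The witness \<open>s + e\<close> is positive even when \<open>s = 0\<close>, so
    demanding \<open>0 < r\<close> does not raise the infimum.\<close>
  proof (rule ennreal_le_epsilon)
    fix e :: real assume "0 < e"
    with real have "ennreal (s + e) \<in> ennreal ` {r. 0 < r \<and> a \<le> ennreal r}"
      by (intro imageI) simp
    from Inf_lower[OF this] real \<open>0 < e\<close> show "Inf (ennreal ` {r. 0 < r \<and> a \<le> ennreal r}) \<le> a + ennreal e"
      by simp
  qed
  then show ?thesis by (rule antisym) (auto intro: Inf_greatest)
\<comment> \<open>For infinite \<open>a\<close> no real bound exists, and the infimum of the empty
  set is infinity.\<close>
qed (simp add: top_unique)

lemma best_constant_eq:
  assumes "\<sigma> \<in> Mplus" "0 < q"
  shows "best_constant \<sigma> q = epowr (\<integral>\<^sup>+ x. ennreal (x powr q) \<partial>\<sigma>) (1 / q)"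
  by (simp add: best_constant_def admissible_iff[OF assms] Inf_ennreal_positive_upper_bounds)

theorem proposition2p7:
  fixes \<sigma> :: "real measure" and q :: real
  assumes "\<sigma> \<in> Mplus" and "0 < q" and "q < 1"
  shows "((\<exists>\<kappa>. admissible \<sigma> q \<kappa>) \<longleftrightarrow> (\<integral>\<^sup>+ x. ennreal (x powr q) \<partial>\<sigma>) < \<infinity>) \<and>
    epowr (best_constant \<sigma> q) q = (\<integral>\<^sup>+ x. ennreal (x powr q) \<partial>\<sigma>)"
proof
  show "(\<exists>\<kappa>. admissible \<sigma> q \<kappa>) \<longleftrightarrow> (\<integral>\<^sup>+ x. ennreal (x powr q) \<partial>\<sigma>) < \<infinity>"
  proof
    assume "\<exists>\<kappa>. admissible \<sigma> q \<kappa>"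
    then show "(\<integral>\<^sup>+ x. ennreal (x powr q) \<partial>\<sigma>) < \<infinity>"
      using admissible_imp[OF assms(1,2)] le_less_trans[OF _ ennreal_less_top] by auto
  next
    assume "(\<integral>\<^sup>+ x. ennreal (x powr q) \<partial>\<sigma>) < \<infinity>"
    then obtain r where "0 \<le> r" "(\<integral>\<^sup>+ x. ennreal (x powr q) \<partial>\<sigma>) = ennreal r"
      by (cases "\<integral>\<^sup>+ x. ennreal (x powr q) \<partial>\<sigma>") auto
    \<comment> \<open>Adding 1 keeps the constant positive when the integral vanishes.\<close>
    then have "admissible \<sigma> q (r powr (1 / q) + 1)"
      by (simp add: admissible_iff[OF assms(1,2)] add_nonneg_pos)
    then show "\<exists>\<kappa>. admissible \<sigma> q \<kappa>" ..
  qed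
  show "epowr (best_constant \<sigma> q) q = (\<integral>\<^sup>+ x. ennreal (x powr q) \<partial>\<sigma>)"
    \<comment> \<open>Inverting the power also covers an infinite integral, where both sides are
      infinite.\<close>
    using assms by (simp add: best_constant_eq epowr_epowr_inverse)
qed

end
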